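(* Let $n$ be a positive integer and $\mathbb{K}$ a semifield. Let $u\in\mathbb{K}^n$ and $x\in\mathbb{K}^n$ be two $n$-tuples. Let $(a',b')=\eta(u,x)$. Then $$\mathbf{f}_u(x)=u\,\frac{a'}{b'},$$ where $\mathbf{f}_u$, $\eta$ and the entrywise product and quotient of $n$-tuples are as defined in the context.
   Context: A semifield is a set $\mathbb{K}$ with two binary operations $+$ and $\cdot$ and an element $1$ such that $(\mathbb{K},+)$ is a commutative semigroup (no zero element required), $(\mathbb{K},\cdot,1)$ is an abelian group, and $\cdot$ distributes over $+$. We write $a/b=\frac{a}{b}=ab^{-1}$; empty products equal $1$. Index convention: for an $n$-tuple $a\in\mathbb{K}^n$ and $i\in\mathbb{Z}$, $a_i$ denotes the $i'$-th entry of $a$, where $i'\in\{1,\ldots,n\}$ is the unique element with $i'\equiv i\bmod n$. Definition of $\mathbf{f}_u$: Let $x\in\mathbb{K}^n$. For each $j\in\mathbb{Z}$ and $r\in\mathbb{N}=\{0,1,2,\ldots\}$, set $t_{r,j}=\sum_{k=0}^{r}\left(\prod_{i=1}^{k}x_{j+i}\right)\left(\prod_{i=k+1}^{r}u_{j+i}\right)\in\mathbb{K}$. Define $y\in\mathbb{K}^n$ by $y_i=u_i\cdot\dfrac{u_{i-1}t_{n-1,i-1}}{x_{i+1}t_{n-1,i+1}}$ for each $i\in\{1,\ldots,n\}$. Set $\mathbf{f}_u(x)=y$. Definition of the birational R-matrix $\eta:\mathbb{K}^n\times\mathbb{K}^n\to\mathbb{K}^n\times\mathbb{K}^n$: for $a,b\in\mathbb{K}^n$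 and $i\in\mathbb{Z}$, set $\kappa_i(a,b)=\sum_{j=i}^{i+n-1}\left(\prod_{p=i+1}^{j}b_p\right)\left(\prod_{p=j+1}^{i+n-1}a_p\right)$. Define $a',b'\in\mathbb{K}^n$ by $a'_i=\dfrac{a_{i-1}\kappa_{i-1}(a,b)}{\kappa_i(a,b)}$ and $b'_i=\dfrac{b_{i+1}\kappa_{i+1}(a,b)}{\kappa_i(a,b)}$ for each $i\in\{1,\ldots,n\}$, and set $\eta(a,b)=(a',b')$. For $a,b\in\mathbb{K}^n$, the $n$-tuples $ab$ and $\frac{a}{b}$ are defined entrywise: $(ab)_i=a_ib_i$ and $\left(\frac{a}{b}\right)_i=\frac{a_i}{b_i}$ for $i\in\{1,\ldots,n\}$. *)

theory Defs
  imports Main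
begin

(* No zero is required: comm_semiring only asks for a commutative additive semigroup. *)
class semifield = comm_semiring + comm_monoid_mult + inverse +
  assumes semifield_left_inverse: "inverse a * a = 1"
    and semifield_divide_inverse: "a / b = a * inverse b"

(* Since a semifield has no zero, the library's sum (which needs comm_monoid_add) is not
   available.  interval_sum f l m is f l + ... + f m, meaningful only for l \<le> m. *)
definition interval_sum :: "(int \<Rightarrow> 'a::ab_semigroup_add) \<Rightarrow> int \<Rightarrow> int \<Rightarrow> 'a" where
  "interval_sum f l m = foldl (\<lambda>s k. s + f k) (f l) [l + 1..m]"

(* An n-tuple (a_1, ..., a_n) is a list of length n.  Its entries are numbered from 1 and
   the index is an arbitrary integer read modulo n, so that entry a i is the list element
   at 0-based position (i - 1) mod n. *)
definition entry :: "'a list \<Rightarrow> int \<Rightarrow> 'a" where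
  "entry a i = a ! nat ((i - 1) mod int (length a))"

definition tuple_of :: "nat \<Rightarrow> (int \<Rightarrow> 'a) \<Rightarrow> 'a list" where
  "tuple_of n g = map g [1..int n]"

definition t_sum :: "'a::semifield list \<Rightarrow> 'a list \<Rightarrow> nat \<Rightarrow> int \<Rightarrow> 'a" where
  "t_sum u x r j =
    interval_sum (\<lambda>k. (\<Prod>i\<in>{1..k}. entry x (j + i)) * (\<Prod>i\<in>{k+1..int r}. entry u (j + i))) 0 (int r)"

definition f_map :: "'a::semifield list \<Rightarrow> 'a list \<Rightarrow> 'a list" where
  "f_map u x = (let n = length x in
    tuple_of n (\<lambda>i. entry u i *
      ((entry u (i - 1) * t_sum u x (n - 1) (i - 1)) / (entry x (i + 1) * t_sum u x (n - 1) (i + 1)))))"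

definition kappa :: "'a::semifield list \<Rightarrow> 'a list \<Rightarrow> int \<Rightarrow> 'a" where
  "kappa a b i = (let n = int (length a) in
    interval_sum (\<lambda>j. (\<Prod>p\<in>{i+1..j}. entry b p) * (\<Prod>p\<in>{j+1..i+n-1}. entry a p)) i (i + n - 1))"

definition eta :: "'a::semifield list \<times> 'a list \<Rightarrow> 'a list \<times> 'a list" where
  "eta = (\<lambda>(a, b). let n = length a in
    (tuple_of n (\<lambda>i. entry a (i - 1) * kappa a b (i - 1) / kappa a b i),
     tuple_of n (\<lambda>i. entry b (i + 1) * kappa a b (i + 1) / kappa a b i)))"

abbreviation tuple_times :: "'a::semifield list \<Rightarrow> 'a list \<Rightarrow> 'a list" where
  "tuple_times a b \<equiv> map2 (*) a b"

abbreviation tuple_divide :: "'a::semifield list \<Rightarrow> 'a list \<Rightarrow> 'a list" where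
  "tuple_divide a b \<equiv> map2 (/) a b"

end

theory Submission
  imports Defs
begin

text \<open>
  The two maps are built from the same sums. Shifting the summation index of
  \<open>kappa u x i\<close> by \<open>i\<close> turns it into \<open>t_sum u x (n - 1) i\<close>. In the entrywise quotient of the two
  components of the birational R-matrix the common denominator \<open>kappa u x i\<close> cancels, which leaves
  \<open>(u\<^sub>i\<^sub>-\<^sub>1 * kappa u x (i - 1)) / (x\<^sub>i\<^sub>+\<^sub>1 * kappa u x (i + 1))\<close>; after multiplication by
  \<open>u\<^sub>i\<close> this is the defining formula of the \<open>i\<close>-th entry of \<open>f_map u x\<close>.
\<close>

lemma semifield_inverse_unique:
  fixes a b :: "'a::semifield"
  assumes "a * b = 1"
  shows "inverse a = b"
proof -
  have "inverse a = inverse a * (a * b)" using assms by simp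
  also have "\<dots> = (inverse a * a) * b" by (simp only: mult.assoc)
  also have "\<dots> = b" by (simp add: semifield_left_inverse)
  finally show ?thesis .
qed

lemma semifield_divide_cancel_denominator:
  fixes a b c :: "'a::semifield"
  shows "(a / c) / (b / c) = a / b"
proof -
  have "(b * inverse c) * (inverse b * c) = (inverse b * b) * (inverse c * c)"
    by (simp only: ac_simps)
  then have "inverse (b * inverse c) = inverse b * c"
    by (intro semifield_inverse_unique) (simp add: semifield_left_inverse)
  then have "(a / c) / (b / c) = (a * inverse b) * (inverse c * c)"
    by (simp only: semifield_divide_inverse ac_simps)
  then show ?thesis
    by (simp add: semifield_left_inverse semifield_divide_inverse)
qed

lemma upto_shift: "[l + c..m + c] = map (\<lambda>k. k + c) [l..m]" for l m c :: int
  by (rule nth_equalityI) auto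

lemma interval_sum_shift:
  "interval_sum f (l + c) (m + c) = interval_sum (\<lambda>k. f (k + c)) l m"
  using upto_shift[of "l + 1" c m]
  by (simp add: interval_sum_def foldl_map ac_simps)

lemma prod_int_interval_shift:
  fixes f :: "int \<Rightarrow> 'a::comm_monoid_mult"
  shows "(\<Prod>p\<in>{l + c..m + c}. f p) = (\<Prod>p\<in>{l..m}. f (c + p))"
  by (rule prod.reindex_bij_witness[of _ "\<lambda>p. c + p" "\<lambda>p. p - c"]) auto

text \<open>
  Positivity of \<open>n\<close> matters here: the upper summation limit of \<open>t_sum\<close> is a truncated natural
  number subtraction, whereas that of \<open>kappa\<close> is an integer subtraction.
\<close>
lemma kappa_eq_t_sum:
  fixes u x :: "'a::semifield list"
  assumes "length u = n" and "n > 0"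
  shows "kappa u x i = t_sum u x (n - 1) i"
proof -
  have x_prod: "(\<Prod>p\<in>{i + 1..k + i}. entry x p) = (\<Prod>p\<in>{1..k}. entry x (i + p))" for k
    using prod_int_interval_shift[of "entry x" 1 i k] by (simp add: ac_simps)
  have u_prod: "(\<Prod>p\<in>{k + i + 1..i + int n - 1}. entry u p)
      = (\<Prod>p\<in>{k + 1..int n - 1}. entry u (i + p))" for k
    using prod_int_interval_shift[of "entry u" "k + 1" i "int n - 1"]
    by (simp add: algebra_simps)
  have "kappa u x i = interval_sum
      (\<lambda>j. (\<Prod>p\<in>{i + 1..j}. entry x p) * (\<Prod>p\<in>{j + 1..i + int n - 1}. entry u p))
      (0 + i) ((int n - 1) + i)"
    by (simp add: kappa_def Let_def assms(1) add.commute[of _ i] add_diff_eq)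
  also have "\<dots> = interval_sum
      (\<lambda>k. (\<Prod>p\<in>{1..k}. entry x (i + p)) * (\<Prod>p\<in>{k + 1..int n - 1}. entry u (i + p)))
      0 (int n - 1)"
    by (simp only: interval_sum_shift x_prod u_prod)
  also have "\<dots> = t_sum u x (n - 1) i"
    using assms(2) by (simp add: t_sum_def)
  finally show ?thesis .
qed

lemma map2_tuple_of:
  "map2 h (tuple_of n f) (tuple_of n g) = tuple_of n (\<lambda>i. h (f i) (g i))"
  by (simp add: tuple_of_def map2_map_map)

lemma tuple_of_entry: "tuple_of (length a) (entry a) = a"
  by (rule nth_equalityI) (auto simp: tuple_of_def entry_def)

theorem theorem5p12:
  fixes n :: nat and u x a' b' :: "'a::semifield list"
  assumes "n > 0"
    and "length u = n" and "length x = n"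
    and "eta (u, x) = (a', b')"
  shows "f_map u x = tuple_times u (tuple_divide a' b')"
proof -
  have a': "a' = tuple_of n (\<lambda>i. entry u (i - 1) * kappa u x (i - 1) / kappa u x i)"
    and b': "b' = tuple_of n (\<lambda>i. entry x (i + 1) * kappa u x (i + 1) / kappa u x i)"
    using assms(2,4) by (simp_all add: eta_def Let_def)
  have "tuple_divide a' b' = tuple_of n
      (\<lambda>i. (entry u (i - 1) * kappa u x (i - 1)) / (entry x (i + 1) * kappa u x (i + 1)))"
    by (simp only: a' b' map2_tuple_of semifield_divide_cancel_denominator)
  then have "tuple_times u (tuple_divide a' b') = tuple_of n (\<lambda>i. entry u i *
      ((entry u (i - 1) * kappa u x (i - 1)) / (entry x (i + 1) * kappa u x (i + 1))))"
    using map2_tuple_of[of "(*)" n "entry u"] tuple_of_entry[of u] assms(2) by simp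
  also have "\<dots> = f_map u x"
    by (simp only: f_map_def Let_def assms(3) kappa_eq_t_sum[OF assms(2,1)])
  finally show ?thesis by (rule sym)
qed

end
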